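(* Let $(X,d)$ be a compact metric space and $T:X\to X$ a map that is Lipschitz with respect to $d$ and has positive topological entropy. Then there exist $C,\alpha>0$ such that for all $0<\epsilon<1$, $$h_{W_1}(T_*,\epsilon)\ge C\epsilon^{-\alpha}.$$
   Context: $\mathcal{M}(X)$ is the space of Borel probability measures on $X$ with the weak-$*$ topology, and $T_*\mu=\mu\circ T^{-1}$. $W_1$ is the $1$-Wasserstein distance on $\mathcal{M}(X)$ associated to $d$: $W_1(\mu,\nu)=\inf_{\gamma}\int d(x,y)\,d\gamma(x,y)$, the infimum over all Borel probability measures $\gamma$ on $X\times X$ with marginals $\mu$ and $\nu$. For a compact metric space $(Y,\rho)$ and continuous $S:Y\to Y$, let $\rho_n(x,y)=\max_{0\le i\le n-1}\rho(S^ix,S^iy)$, let $s_n(\rho,S,Y,\epsilon)$ be the largest cardinality of a set $E\subset Y$ with $\rho_n(x,y)>\epsilon$ for all distinct $x,y\in E$, and $h_\rho(S,\epsilon)=\limsup_{n\to\infty}\frac1n\log s_n(\rho,S,Y,\epsilon)$. Here this is applied to $Y=\mathcal{M}(X)$, $\rho=W_1$, $S=T_*$.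
   Formalization: The bound is proved for all 0 < ε < ε₀ with some ε₀ > 0 depending on X, d and T, instead of all 0 < ε < 1; the printed range fails, e.g. for the doubling map on a circle of diameter 1/5, where the entropy at ε = 1/2 is 0. *)

theory Defs
  imports "HOL-Probability.Probability"
begin

definition borel_probs :: "'a::metric_space set \<Rightarrow> 'a measure set" where
  "borel_probs X = {\<mu>. prob_space \<mu> \<and> sets \<mu> = sets (restrict_space borel X)}"

definition pushforward :: "'a::metric_space set \<Rightarrow> ('a \<Rightarrow> 'a) \<Rightarrow> 'a measure \<Rightarrow> 'a measure" where
  "pushforward X T \<mu> = distr \<mu> (restrict_space borel X) T"

definition couplings ::
  "'a::metric_space set \<Rightarrow> 'a measure \<Rightarrow> 'a measure \<Rightarrow> ('a \<times> 'a) measure set" where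
  "couplings X \<mu> \<nu> = {\<gamma>. prob_space \<gamma> \<and> sets \<gamma> = sets (restrict_space borel (X \<times> X)) \<and>
     distr \<gamma> (restrict_space borel X) fst = \<mu> \<and> distr \<gamma> (restrict_space borel X) snd = \<nu>}"

definition wasserstein1 :: "'a::metric_space set \<Rightarrow> 'a measure \<Rightarrow> 'a measure \<Rightarrow> real" where
  "wasserstein1 X \<mu> \<nu> = (INF \<gamma>\<in>couplings X \<mu> \<nu>. \<integral>p. dist (fst p) (snd p) \<partial>\<gamma>)"

definition dyn_dist :: "('b \<Rightarrow> 'b \<Rightarrow> real) \<Rightarrow> ('b \<Rightarrow> 'b) \<Rightarrow> nat \<Rightarrow> 'b \<Rightarrow> 'b \<Rightarrow> real" where
  "dyn_dist \<rho> S n x y = (MAX i\<in>{..<n}. \<rho> ((S ^^ i) x) ((S ^^ i) y))"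

definition separated ::
  "('b \<Rightarrow> 'b \<Rightarrow> real) \<Rightarrow> ('b \<Rightarrow> 'b) \<Rightarrow> nat \<Rightarrow> real \<Rightarrow> 'b set \<Rightarrow> bool" where
  "separated \<rho> S n \<epsilon> E \<longleftrightarrow> (\<forall>x\<in>E. \<forall>y\<in>E. x \<noteq> y \<longrightarrow> dyn_dist \<rho> S n x y > \<epsilon>)"

text \<open>The largest cardinality of a separated subset of \<open>Y\<close>. On a compact space with a continuous
  map it is attained; otherwise it may be \<open>\<infinity>\<close>. An infinite separated set has finite separated
  subsets of every size, so finite sets suffice.\<close>

definition sep_number ::
  "('b \<Rightarrow> 'b \<Rightarrow> real) \<Rightarrow> ('b \<Rightarrow> 'b) \<Rightarrow> 'b set \<Rightarrow> real \<Rightarrow> nat \<Rightarrow> enat" where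
  "sep_number \<rho> S Y \<epsilon> n = (SUP E\<in>{E. finite E \<and> E \<subseteq> Y \<and> separated \<rho> S n \<epsilon> E}. enat (card E))"

text \<open>Since \<open>ln 0 = 0\<close>, the empty space gets entropy \<open>0\<close>.\<close>

definition ln_enat :: "enat \<Rightarrow> ereal" where
  "ln_enat k = (case k of enat m \<Rightarrow> ereal (ln (real m)) | \<infinity> \<Rightarrow> \<infinity>)"

definition scale_entropy ::
  "('b \<Rightarrow> 'b \<Rightarrow> real) \<Rightarrow> ('b \<Rightarrow> 'b) \<Rightarrow> 'b set \<Rightarrow> real \<Rightarrow> ereal" where
  "scale_entropy \<rho> S Y \<epsilon> = limsup (\<lambda>n. ereal (1 / real n) * ln_enat (sep_number \<rho> S Y \<epsilon> n))"

text \<open>Bowen's definition. The limit always exists, because the entropy at scale \<open>\<epsilon>\<close> is antitone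
  in \<open>\<epsilon>\<close>; see \<open>topological_entropy_eq_SUP\<close> below.\<close>

definition topological_entropy ::
  "('b \<Rightarrow> 'b \<Rightarrow> real) \<Rightarrow> ('b \<Rightarrow> 'b) \<Rightarrow> 'b set \<Rightarrow> ereal" where
  "topological_entropy \<rho> S Y = Lim (at_right 0) (scale_entropy \<rho> S Y)"

lemma sep_number_antimono:
  assumes "\<epsilon> \<le> \<epsilon>'"
  shows "sep_number \<rho> S Y \<epsilon>' n \<le> sep_number \<rho> S Y \<epsilon> n"
  unfolding sep_number_def separated_def
  by (rule SUP_subset_mono) (use assms in \<open>auto dest: order.strict_trans1\<close>)

lemma ln_enat_mono: "k \<le> l \<Longrightarrow> ln_enat k \<le> ln_enat l"
proof (cases k; cases l)
  fix a b assume "k \<le> l" and kl: "k = enat a" "l = enat b"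
  then have "a \<le> b" by simp
  then have "ln (real a) \<le> ln (real b)"
    by (cases "a = 0"; cases "b = 0") (auto simp: ln_ge_zero)
  then show "ln_enat k \<le> ln_enat l" by (simp add: ln_enat_def kl)
qed (auto simp: ln_enat_def)

lemma scale_entropy_antimono:
  assumes "\<epsilon> \<le> \<epsilon>'"
  shows "scale_entropy \<rho> S Y \<epsilon>' \<le> scale_entropy \<rho> S Y \<epsilon>"
  unfolding scale_entropy_def
  by (intro Limsup_mono always_eventually allI ereal_mult_left_mono ln_enat_mono
      sep_number_antimono assms) simp

lemma topological_entropy_eq_SUP:
  "topological_entropy \<rho> S Y = (SUP \<epsilon>\<in>{0<..}. scale_entropy \<rho> S Y \<epsilon>)"
proof -
  let ?h = "scale_entropy \<rho> S Y"
  have "(?h \<longlongrightarrow> (SUP \<epsilon>\<in>{0<..}. ?h \<epsilon>)) (at_right 0)"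
  proof (rule increasing_tendsto)
    show "\<forall>\<^sub>F \<epsilon> in at_right 0. ?h \<epsilon> \<le> (SUP \<epsilon>\<in>{0<..}. ?h \<epsilon>)"
      by (rule eventually_at_right_less[THEN eventually_mono]) (auto intro: SUP_upper)
  next
    fix x assume "x < (SUP \<epsilon>\<in>{0<..}. ?h \<epsilon>)"
    then obtain \<delta> where "\<delta> > 0" "x < ?h \<delta>" by (auto simp: less_SUP_iff)
    then show "\<forall>\<^sub>F \<epsilon> in at_right 0. x < ?h \<epsilon>"
      unfolding eventually_at_right_field
      by (intro exI[of _ \<delta>]) (auto intro: less_le_trans[OF _ scale_entropy_antimono])
  qed
  then show ?thesis
    unfolding topological_entropy_def by (intro tendsto_Lim) simp_all
qed

end

theory Submission imports Defs begin

text \<open>Fix \<open>\<delta>\<close> and \<open>h > 0\<close> such that for infinitely many \<open>n\<close> there is an \<open>(n, \<delta>)\<close>-separated set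
  \<open>E\<close> with more than \<open>exp (h n)\<close> points. Cut \<open>{0..<n}\<close> into about \<open>n / m\<close> blocks of length \<open>m\<close> and consider
  the uniform measures on \<open>s\<close>-tuples from \<open>E\<close>, where \<open>s \<approx> exp (h m / 8)\<close>. Put
  \<open>r = \<delta> / (2 L\<^sup>m)\<close>. If two such measures stay \<open>W\<^sub>1\<close>-close at scale \<open>\<epsilon> = const * L\<^sup>-\<^sup>m\<close> along the orbit, then at the
  start of each block, by Markov's inequality, all but a small proportion of the points of the
  second tuple are within \<open>r\<close> of a point of the first, hence shadow it throughout the block. So the
  second tuple is determined by the first together with, for each block, the exceptional indices,
  the choice of a shadowed point for the others, and the itineraries of the exceptional points.
  That is at most \<open>exp (3/8 * h m s)\<close> possibilities per block, against more than \<open>exp (h n s)\<close> tuples. A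
  maximal separated set of such measures therefore has at least \<open>exp (h n s / 4)\<close> elements, and \<open>s\<close> is
  a power of \<open>1 / \<epsilon>\<close> up to a constant.\<close>

section \<open>Empirical measures of tuples and their push-forwards\<close>

text \<open>Defined through the indices, so that repeated entries count with multiplicity,
  push-forwards act by composition and two tuples can be coupled index by index.\<close>

definition empirical :: "'a::metric_space set \<Rightarrow> nat \<Rightarrow> (nat \<Rightarrow> 'a) \<Rightarrow> 'a measure" where
  "empirical X s x = distr (uniform_count_measure {..<s}) (restrict_space borel X) x"

lemma measurable_uniform_count_restrict:
  assumes "x \<in> {..<s} \<rightarrow> X"
  shows "x \<in> uniform_count_measure {..<s} \<rightarrow>\<^sub>M restrict_space borel X"
  using assms by (auto simp: measurable_def space_uniform_count_measure
      sets_uniform_count_measure space_restrict_space)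

lemma prob_space_uniform_count_lessThan:
  "0 < (s::nat) \<Longrightarrow> prob_space (uniform_count_measure {..<s})"
  by (rule prob_space_uniform_count_measure) auto

lemma empirical_in_borel_probs:
  assumes "0 < s" "x \<in> {..<s} \<rightarrow> X"
  shows "empirical X s x \<in> borel_probs X"
  using assms unfolding borel_probs_def empirical_def
  by (auto intro!: prob_space.prob_space_distr prob_space_uniform_count_lessThan
      measurable_uniform_count_restrict)

lemma measure_empirical:
  assumes "0 < s" "x \<in> {..<s} \<rightarrow> X" "A \<in> sets (restrict_space borel X)"
  shows "measure (empirical X s x) A = card {i\<in>{..<s}. x i \<in> A} / s"
proof -
  have "x -` A \<inter> space (uniform_count_measure {..<s}) = {i\<in>{..<s}. x i \<in> A}"
    by (auto simp: space_uniform_count_measure)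
  then show ?thesis
    unfolding empirical_def
    by (subst measure_distr[OF measurable_uniform_count_restrict[OF assms(2)] assms(3)])
       (simp only:, subst measure_uniform_count_measure, auto)
qed

lemma measurable_restrict_continuous:
  assumes "continuous_on A f" "f \<in> A \<rightarrow> B"
  shows "f \<in> restrict_space borel A \<rightarrow>\<^sub>M restrict_space borel B"
  using assms by (intro measurable_restrict_space2 borel_measurable_continuous_on_restrict)
    (auto simp: space_restrict_space)

lemma funpow_in: "T \<in> X \<rightarrow> X \<Longrightarrow> x \<in> X \<Longrightarrow> (T ^^ i) x \<in> X"
  by (induction i) auto

lemma pushforward_empirical:
  assumes "continuous_on X T" "T \<in> X \<rightarrow> X" "x \<in> {..<s} \<rightarrow> X"
  shows "pushforward X T (empirical X s x) = empirical X s (T \<circ> x)"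
  unfolding pushforward_def empirical_def
  by (rule distr_distr[OF measurable_restrict_continuous measurable_uniform_count_restrict])
     (use assms in auto)

lemma pushforward_funpow_empirical:
  assumes "continuous_on X T" "T \<in> X \<rightarrow> X" "x \<in> {..<s} \<rightarrow> X"
  shows "(pushforward X T ^^ i) (empirical X s x) = empirical X s (\<lambda>j. (T ^^ i) (x j))"
proof (induction i)
  case (Suc i)
  have "(\<lambda>j. (T ^^ i) (x j)) \<in> {..<s} \<rightarrow> X"
    using assms(2,3) by (auto intro: funpow_in)
  then show ?case
    by (simp add: Suc pushforward_empirical[OF assms(1,2)] comp_def)
qed simp

section \<open>Couplings and Wasserstein distance of empirical measures\<close>

text \<open>Supplies an element of the set over which \<open>wasserstein1\<close> takes its infimum;
  for \<open>x = y\<close> it is the diagonal coupling, of cost 0.\<close>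

lemma index_coupling:
  assumes "0 < s" "x \<in> {..<s} \<rightarrow> X" "y \<in> {..<s} \<rightarrow> X"
  shows "distr (uniform_count_measure {..<s}) (restrict_space borel (X \<times> X)) (\<lambda>i. (x i, y i))
    \<in> couplings X (empirical X s x) (empirical X s y)" (is "?\<gamma> \<in> _")
proof -
  let ?U = "uniform_count_measure {..<s}"
  have m: "(\<lambda>i. (x i, y i)) \<in> ?U \<rightarrow>\<^sub>M restrict_space borel (X \<times> X)"
    by (rule measurable_uniform_count_restrict) (use assms in auto)
  have "prob_space ?\<gamma>"
    by (intro prob_space.prob_space_distr prob_space_uniform_count_lessThan assms m)
  moreover have "distr ?\<gamma> (restrict_space borel X) fst = empirical X s x"
    unfolding empirical_def
    by (subst distr_distr[OF measurable_restrict_continuous m])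
       (auto intro: continuous_intros simp: comp_def)
  moreover have "distr ?\<gamma> (restrict_space borel X) snd = empirical X s y"
    unfolding empirical_def
    by (subst distr_distr[OF measurable_restrict_continuous m])
       (auto intro: continuous_intros simp: comp_def)
  ultimately show ?thesis by (simp add: couplings_def)
qed

lemma wasserstein1_empirical_refl:
  assumes "0 < s" "x \<in> {..<s} \<rightarrow> X"
  shows "wasserstein1 X (empirical X s x) (empirical X s x) \<le> 0"
proof -
  let ?U = "uniform_count_measure {..<s}"
  let ?\<gamma> = "distr ?U (restrict_space borel (X \<times> X)) (\<lambda>i. (x i, x i))"
  have m: "(\<lambda>i. (x i, x i)) \<in> ?U \<rightarrow>\<^sub>M restrict_space borel (X \<times> X)"
    by (rule measurable_uniform_count_restrict) (use assms in auto)
  have d: "(\<lambda>p. dist (fst p) (snd p)) \<in> restrict_space borel (X \<times> X) \<rightarrow>\<^sub>M (borel :: real measure)"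
    by (intro borel_measurable_continuous_on_restrict continuous_intros)
  have "wasserstein1 X (empirical X s x) (empirical X s x) \<le> (\<integral>p. dist (fst p) (snd p) \<partial>?\<gamma>)"
    unfolding wasserstein1_def
    by (rule cINF_lower[OF _ index_coupling[OF assms assms(2)]]) (auto intro!: bdd_belowI[of _ 0])
  also have "\<dots> = 0"
    by (subst integral_distr[OF m d]) simp
  finally show ?thesis .
qed

lemma sets_restrict_space_Int: "A \<in> sets M \<Longrightarrow> A \<inter> X \<in> sets (restrict_space M X)"
  by (auto simp: sets_restrict_space)

text \<open>Markov's inequality: the counted points carry mass \<open>card / s\<close> under the law
  of \<open>g\<close>, and coupling them to points of \<open>x\<close> costs at least
  \<open>r\<close> per unit of mass. General maps \<open>f\<close> and \<open>g\<close> let either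
  coordinate of a coupling play either part.\<close>

lemma card_far_points:
  assumes "prob_space \<gamma>" and s: "0 < s" "x \<in> {..<s} \<rightarrow> X" "y \<in> {..<s} \<rightarrow> X"
    and f: "f \<in> \<gamma> \<rightarrow>\<^sub>M restrict_space borel X" "distr \<gamma> (restrict_space borel X) f = empirical X s x"
    and g: "g \<in> \<gamma> \<rightarrow>\<^sub>M restrict_space borel X" "distr \<gamma> (restrict_space borel X) g = empirical X s y"
    and int: "integrable \<gamma> (\<lambda>p. dist (f p) (g p))" "(\<integral>p. dist (f p) (g p) \<partial>\<gamma>) \<le> a"
    and "0 < r"
  shows "real (card {i\<in>{..<s}. \<forall>j<s. r \<le> dist (x j) (y i)}) * r \<le> s * a"
proof -
  interpret prob_space \<gamma> by fact
  define B where "B = {z. \<forall>j<s. r \<le> dist (x j) z} \<inter> X"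
  have "closed {z. \<forall>j<s. r \<le> dist (x j) z}"
    by (intro closed_Collect_all closed_Collect_imp closed_Collect_le continuous_intros) auto
  then have B: "B \<in> sets (restrict_space borel X)"
    unfolding B_def by (intro sets_restrict_space_Int borel_closed)
  define A where "A = X - x ` {..<s}"
  have "closed (x ` {..<s})" by (simp add: finite_imp_closed)
  then have "- x ` {..<s} \<in> sets borel" by simp
  then have A: "A \<in> sets (restrict_space borel X)"
    unfolding A_def Diff_eq by (subst Int_commute) (rule sets_restrict_space_Int)
  have D: "{p\<in>space \<gamma>. r \<le> dist (f p) (g p)} \<in> sets \<gamma>"
    by (intro borel_measurable_le borel_measurable_const borel_measurable_integrable int(1))
  \<comment> \<open>\<open>f\<close> takes its values in \<open>{x j | j < s}\<close> almost surely, so where \<open>g\<close> lies in \<open>B\<close> the cost is at least \<open>r\<close>.\<close>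
  have "measure \<gamma> (f -` A \<inter> space \<gamma>) = 0"
    using measure_empirical[OF s(1,2) A] measure_distr[OF f(1) A] f(2)
    by (auto simp: A_def cong: conj_cong)
  moreover have "measure \<gamma> (g -` B \<inter> space \<gamma>) = card {i\<in>{..<s}. y i \<in> B} / s"
    using measure_empirical[OF s(1,3) B] measure_distr[OF g(1) B] g(2) by simp
  moreover have "{i\<in>{..<s}. y i \<in> B} = {i\<in>{..<s}. \<forall>j<s. r \<le> dist (x j) (y i)}"
    using s(3) by (auto simp: B_def)
  moreover have "measure \<gamma> (g -` B \<inter> space \<gamma>)
      \<le> measure \<gamma> (f -` A \<inter> space \<gamma> \<union> {p\<in>space \<gamma>. r \<le> dist (f p) (g p)})"
  proof (rule finite_measure_mono)
    show "g -` B \<inter> space \<gamma> \<subseteq> f -` A \<inter> space \<gamma> \<union> {p\<in>space \<gamma>. r \<le> dist (f p) (g p)}"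
      using measurable_space[OF f(1)] by (auto simp: A_def B_def space_restrict_space)
    show "f -` A \<inter> space \<gamma> \<union> {p\<in>space \<gamma>. r \<le> dist (f p) (g p)} \<in> sets \<gamma>"
      using measurable_sets[OF f(1) A] D by (rule sets.Un)
  qed
  moreover have "measure \<gamma> (f -` A \<inter> space \<gamma> \<union> {p\<in>space \<gamma>. r \<le> dist (f p) (g p)})
      \<le> measure \<gamma> (f -` A \<inter> space \<gamma>) + measure \<gamma> {p\<in>space \<gamma>. r \<le> dist (f p) (g p)}"
    using measurable_sets[OF f(1) A] D by (rule measure_Un_le)
  moreover have "measure \<gamma> {p\<in>space \<gamma>. r \<le> dist (f p) (g p)} \<le> (\<integral>p. dist (f p) (g p) \<partial>\<gamma>) / r"
    using integral_Markov_inequality_measure[OF int(1), of "{}" r] \<open>0 < r\<close> by simp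
  ultimately have "card {i\<in>{..<s}. \<forall>j<s. r \<le> dist (x j) (y i)} / s \<le> (\<integral>p. dist (f p) (g p) \<partial>\<gamma>) / r"
    by simp
  also have "\<dots> \<le> a / r" using int(2) \<open>0 < r\<close> by (simp add: divide_right_mono)
  finally show ?thesis using s(1) \<open>0 < r\<close> by (simp add: field_simps)
qed

text \<open>The strict inequality provides a coupling of cost below \<open>a\<close>, and
  boundedness of \<open>X\<close> makes its cost integrable. Both bounds come from this one coupling
  by exchanging coordinates, so symmetry of \<open>wasserstein1\<close> is never invoked.\<close>

lemma wasserstein1_card_far_points:
  fixes X :: "'a::metric_space set"
  assumes X: "compact X" and s: "0 < s" "x \<in> {..<s} \<rightarrow> X" "y \<in> {..<s} \<rightarrow> X"
    and w: "wasserstein1 X (empirical X s x) (empirical X s y) < a" and r: "0 < r"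
  shows "real (card {i\<in>{..<s}. \<forall>j<s. r \<le> dist (x j) (y i)}) * r \<le> s * a"
    and "real (card {i\<in>{..<s}. \<forall>j<s. r \<le> dist (y j) (x i)}) * r \<le> s * a"
proof -
  obtain \<gamma> where g: "\<gamma> \<in> couplings X (empirical X s x) (empirical X s y)"
    and I: "(\<integral>p. dist (fst p) (snd p) \<partial>\<gamma>) < a"
    using cInf_lessD[OF _ w[unfolded wasserstein1_def]] index_coupling[OF s] by blast
  have sets: "sets \<gamma> = sets (restrict_space borel (X \<times> X))" and p: "prob_space \<gamma>"
    and f: "distr \<gamma> (restrict_space borel X) fst = empirical X s x"
           "distr \<gamma> (restrict_space borel X) snd = empirical X s y"
    using g by (auto simp: couplings_def)
  interpret prob_space \<gamma> by fact
  have sp: "space \<gamma> = X \<times> X"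
    using sets_eq_imp_space_eq[OF sets] by (simp add: space_restrict_space)
  have m: "fst \<in> \<gamma> \<rightarrow>\<^sub>M restrict_space borel X" "snd \<in> \<gamma> \<rightarrow>\<^sub>M restrict_space borel X"
    by (subst measurable_cong_sets[OF sets refl];
        auto intro!: measurable_restrict_continuous continuous_intros)+
  have d: "(\<lambda>p. dist (fst p) (snd p)) \<in> borel_measurable \<gamma>"
    by (subst measurable_cong_sets[OF sets refl])
       (intro borel_measurable_continuous_on_restrict continuous_intros)
  obtain e where e: "\<And>u v. u \<in> X \<Longrightarrow> v \<in> X \<Longrightarrow> dist u v \<le> e"
    using compact_imp_bounded[OF X] by (auto simp: bounded_two_points)
  have i: "integrable \<gamma> (\<lambda>p. dist (fst p) (snd p))"
    by (rule integrable_const_bound[OF _ d, of e]) (auto simp: sp e intro!: AE_I2)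
  show "real (card {i\<in>{..<s}. \<forall>j<s. r \<le> dist (x j) (y i)}) * r \<le> s * a"
    by (rule card_far_points[OF p s m(1) f(1) m(2) f(2) i _ r]) (use I in simp)
  show "real (card {i\<in>{..<s}. \<forall>j<s. r \<le> dist (y j) (x i)}) * r \<le> s * a"
    by (rule card_far_points[OF p s(1,3,2) m(2) f(2) m(1) f(1) _ _ r])
       (use I i in \<open>simp_all add: dist_commute\<close>)
qed

section \<open>Coding orbits and counting shadowed tuples\<close>

text \<open>Total boundedness: the code of a point is the centre of a ball of radius \<delta>/2
  containing it. Codes are the letters in which itineraries are recorded.\<close>

lemma compact_finite_code:
  fixes X :: "'a::metric_space set"
  assumes "compact X" "0 < \<delta>"
  obtains Q :: "'a set" and c where "finite Q" "c \<in> X \<rightarrow> Q"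
    "\<And>x y. x \<in> X \<Longrightarrow> y \<in> X \<Longrightarrow> c x = c y \<Longrightarrow> dist x y \<le> \<delta>"
proof -
  obtain Q where Q: "finite Q" "X \<subseteq> (\<Union>q\<in>Q. ball q (\<delta>/2))"
    using seq_compact_imp_totally_bounded[of X] assms by (metis compact_eq_seq_compact_metric half_gt_zero)
  define c where "c x = (SOME q. q \<in> Q \<and> dist q x < \<delta>/2)" for x
  have c: "c x \<in> Q \<and> dist (c x) x < \<delta>/2" if "x \<in> X" for x
    unfolding c_def by (rule someI_ex) (use Q(2) that in \<open>fastforce simp: mem_ball\<close>)
  show thesis
  proof (rule that[OF Q(1)])
    show "c \<in> X \<rightarrow> Q" using c by auto
    fix x y assume "x \<in> X" "y \<in> X" "c x = c y"
    then show "dist x y \<le> \<delta>"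
      using c[of x] c[of y] dist_triangle_half_r[of "c x" x \<delta> y] by auto
  qed
qed

lemma dist_funpow_le:
  assumes "L-lipschitz_on X T" "T \<in> X \<rightarrow> X" "x \<in> X" "y \<in> X"
  shows "dist ((T ^^ i) x) ((T ^^ i) y) \<le> L ^ i * dist x y"
proof (induction i)
  case (Suc i)
  have "dist ((T ^^ Suc i) x) ((T ^^ Suc i) y) \<le> L * dist ((T ^^ i) x) ((T ^^ i) y)"
    using lipschitz_onD[OF assms(1)] funpow_in[OF assms(2)] assms(3,4) by simp
  also have "\<dots> \<le> L * (L ^ i * dist x y)"
    using Suc lipschitz_on_nonneg[OF assms(1)] by (rule mult_left_mono)
  finally show ?case by (simp add: mult.assoc)
qed simp

text \<open>Counts the records of an exceptional set with a word attached to each element: at most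
  \<open>2 ^ s\<close> sets, each with at most \<open>card W ^ t\<close> labellings.\<close>

lemma card_partial_words_le:
  fixes W :: "'w set"
  assumes "finite W" "W \<noteq> {}"
  shows "card (SIGMA S:{S. S \<subseteq> {..<s} \<and> card S \<le> t}. S \<rightarrow>\<^sub>E W) \<le> 2 ^ s * card W ^ t"
proof -
  let ?P = "{S. S \<subseteq> {..<s} \<and> card S \<le> t}"
  have fin: "finite ?P" by (rule finite_subset[of _ "Pow {..<s}"]) auto
  have "card (SIGMA S:?P. S \<rightarrow>\<^sub>E W) = (\<Sum>S\<in>?P. card (S \<rightarrow>\<^sub>E W))"
    using fin assms by (intro card_SigmaI) (auto intro!: finite_PiE intro: finite_subset)
  also have "\<dots> \<le> (\<Sum>S\<in>?P. card W ^ t)"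
  proof (rule sum_mono)
    fix S assume S: "S \<in> ?P"
    then have "finite S" by (auto intro: finite_subset)
    then have "card (S \<rightarrow>\<^sub>E W) = card W ^ card S" by (simp add: card_funcsetE)
    also have "\<dots> \<le> card W ^ t"
      using S assms by (intro power_increasing) (auto simp: Suc_le_eq card_gt_0_iff)
    finally show "card (S \<rightarrow>\<^sub>E W) \<le> card W ^ t" .
  qed
  also have "\<dots> = card ?P * card W ^ t" by simp
  also have "card ?P \<le> card (Pow {..<s})" by (rule card_mono) auto
  finally show ?thesis by (simp add: card_Pow)
qed

lemma dyn_dist_le_iff:
  "0 < n \<Longrightarrow> dyn_dist \<rho> S n x y \<le> \<epsilon> \<longleftrightarrow> (\<forall>i<n. \<rho> ((S ^^ i) x) ((S ^^ i) y) \<le> \<epsilon>)"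
  unfolding dyn_dist_def by (subst Max_le_iff) (auto simp: lessThan_empty_iff)

text \<open>In each block, \<open>y\<close> is encoded by its exceptional indices, their coded
  itineraries, and the index of a shadowed point for every other position. These account for the
  factors \<open>2 ^ s\<close>, \<open>card Q ^ (m * t)\<close> and \<open>s ^ s\<close>; separation
  of \<open>E\<close> makes the encoding injective.\<close>

lemma card_shadowed_tuples_le:
  fixes X :: "'a::metric_space set" and Q :: "'q set"
  assumes T: "L-lipschitz_on X T" "T \<in> X \<rightarrow> X" "1 \<le> L"
    and E: "finite E" "E \<subseteq> X" "separated dist T n \<delta> E"
    and c: "finite Q" "Q \<noteq> {}" "c \<in> X \<rightarrow> Q" "\<And>u v. u \<in> X \<Longrightarrow> v \<in> X \<Longrightarrow> c u = c v \<Longrightarrow> dist u v \<le> \<delta>"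
    and n: "0 < n" "n \<le> k * m" "0 < m"
    and r: "L ^ m * r \<le> \<delta> / 2" and x: "x \<in> {..<s} \<rightarrow> X"
  shows "card {y \<in> {..<s} \<rightarrow>\<^sub>E E. \<forall>b<k.
      card {i\<in>{..<s}. \<forall>j<s. r \<le> dist ((T ^^ (b * m)) (x j)) ((T ^^ (b * m)) (y i))} \<le> t}
    \<le> (2 ^ s * card Q ^ (m * t) * s ^ s) ^ k" (is "card ?B \<le> _")
proof -
  define far where "far b y =
    {i\<in>{..<s}. \<forall>j<s. r \<le> dist ((T ^^ (b * m)) (x j)) ((T ^^ (b * m)) (y i))}" for b y
  \<comment> \<open>An exceptional index is sent to itself, so that this table always takes values
    below \<open>s\<close>.\<close>
  define near where "near b y i =
    (if i \<in> far b y then i else SOME j. j < s \<and> dist ((T ^^ (b * m)) (x j)) ((T ^^ (b * m)) (y i)) < r)"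
    for b y i
  have near: "near b y i < s \<and> dist ((T ^^ (b * m)) (x (near b y i))) ((T ^^ (b * m)) (y i)) < r"
    if "i < s" "i \<notin> far b y" for b y i
  proof -
    have "\<exists>j. j < s \<and> dist ((T ^^ (b * m)) (x j)) ((T ^^ (b * m)) (y i)) < r"
      using that by (auto simp: far_def not_le)
    from someI_ex[OF this] show ?thesis using that by (simp add: near_def)
  qed
  have near_less: "near b y i < s" if "i < s" for b y i
    using near[OF that, of b y] that by (cases "i \<in> far b y") (auto simp: near_def)
  define W where "W = {..<m} \<rightarrow>\<^sub>E Q"
  define G where "G = (SIGMA S:{S. S \<subseteq> {..<s} \<and> card S \<le> t}. S \<rightarrow>\<^sub>E W) \<times> ({..<s} \<rightarrow>\<^sub>E {..<s})"
  have W: "finite W" "W \<noteq> {}" "card W = card Q ^ m"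
    using c(1,2) by (simp_all add: W_def card_funcsetE PiE_eq_empty_iff finite_PiE)
  have finP: "finite {S. S \<subseteq> {..<s} \<and> card S \<le> t}"
    by (rule finite_subset[of _ "Pow {..<s}"]) auto
  have "finite (S \<rightarrow>\<^sub>E W)" if "S \<subseteq> {..<s}" for S
    using W(1) finite_subset[OF that] by (simp add: finite_PiE)
  then have finG: "finite G"
    unfolding G_def using finP by (intro finite_cartesian_product finite_SigmaI) (auto intro!: finite_PiE)
  have cardG: "card G \<le> 2 ^ s * card Q ^ (m * t) * s ^ s"
    using card_partial_words_le[OF W(1,2), of s t]
    by (simp only: G_def card_cartesian_product card_funcsetE finite_lessThan card_lessThan
        W(3) power_mult mult_right_mono le0)
  define \<Phi> where "\<Phi> y = (\<lambda>b\<in>{..<k}. ((far b y,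
      \<lambda>i\<in>far b y. \<lambda>j\<in>{..<m}. c ((T ^^ j) ((T ^^ (b * m)) (y i)))), \<lambda>i\<in>{..<s}. near b y i))" for y
  have "\<Phi> ` ?B \<subseteq> {..<k} \<rightarrow>\<^sub>E G"
  proof (clarify)
    fix y assume y: "y \<in> {..<s} \<rightarrow>\<^sub>E E"
      "\<forall>b<k. card {i\<in>{..<s}. \<forall>j<s. r \<le> dist ((T ^^ (b * m)) (x j)) ((T ^^ (b * m)) (y i))} \<le> t"
    have yX: "y i \<in> X" if "i < s" for i using y(1) E(2) that by auto
    show "\<Phi> y \<in> {..<k} \<rightarrow>\<^sub>E G"
      unfolding \<Phi>_def
    proof (rule restrict_PiE_iff[THEN iffD2], rule ballI)
      fix b assume "b \<in> {..<k}"
      then have "card (far b y) \<le> t" using y(2) by (simp add: far_def)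
      moreover have "far b y \<subseteq> {..<s}" by (auto simp: far_def)
      moreover have "(\<lambda>i\<in>far b y. \<lambda>j\<in>{..<m}. c ((T ^^ j) ((T ^^ (b * m)) (y i)))) \<in> far b y \<rightarrow>\<^sub>E W"
      proof (rule restrict_PiE_iff[THEN iffD2], rule ballI)
        fix i assume "i \<in> far b y"
        then have "y i \<in> X" using yX by (simp add: far_def)
        then show "(\<lambda>j\<in>{..<m}. c ((T ^^ j) ((T ^^ (b * m)) (y i)))) \<in> W"
          unfolding W_def restrict_PiE_iff using c(3) funpow_in[OF T(2)] by (metis Pi_iff)
      qed
      moreover have "(\<lambda>i\<in>{..<s}. near b y i) \<in> {..<s} \<rightarrow>\<^sub>E {..<s}"
        using near_less by auto
      ultimately show "((far b y, \<lambda>i\<in>far b y. \<lambda>j\<in>{..<m}. c ((T ^^ j) ((T ^^ (b * m)) (y i)))),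
          \<lambda>i\<in>{..<s}. near b y i) \<in> G"
        by (simp add: G_def)
    qed
  qed
  moreover have "inj_on \<Phi> ?B"
  proof (rule inj_onI)
    fix y z assume yz: "y \<in> ?B" "z \<in> ?B" and eq: "\<Phi> y = \<Phi> z"
    have yE: "y i \<in> E" "z i \<in> E" if "i < s" for i using yz that by auto
    have "y i = z i" if i: "i < s" for i
    proof -
      have "dist ((T ^^ l) (y i)) ((T ^^ l) (z i)) \<le> \<delta>" if "l < n" for l
      proof -
        \<comment> \<open>Time \<open>l\<close> is offset \<open>j\<close> of block
          \<open>b\<close>; the blocks cover all times below \<open>n\<close>, so block
          \<open>b\<close> is among those recorded by \<open>\<Phi>\<close>.\<close>
        define b j where "b = l div m" and "j = l mod m"
        have l: "l = j + b * m" and j: "j < m" using n by (auto simp: b_def j_def)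
        have "b < k"
          using that n unfolding b_def by (intro less_mult_imp_div_less) simp
        then have *: "((far b y, \<lambda>i\<in>far b y. \<lambda>j\<in>{..<m}. c ((T ^^ j) ((T ^^ (b * m)) (y i)))), \<lambda>i\<in>{..<s}. near b y i)
           = ((far b z, \<lambda>i\<in>far b z. \<lambda>j\<in>{..<m}. c ((T ^^ j) ((T ^^ (b * m)) (z i)))), \<lambda>i\<in>{..<s}. near b z i)"
          using fun_cong[OF eq, of b] by (simp only: \<Phi>_def restrict_apply' lessThan_iff)
        define u v where "u = (T ^^ (b * m)) (y i)" and "v = (T ^^ (b * m)) (z i)"
        have uv: "u \<in> X" "v \<in> X"
          using yE[OF i] E(2) funpow_in[OF T(2)] by (auto simp: u_def v_def)
        have far: "far b y = far b z" using * by simp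
        have "dist ((T ^^ j) u) ((T ^^ j) v) \<le> \<delta>"
        proof (cases "i \<in> far b y")
          \<comment> \<open>For an exceptional index, equal letters at offset \<open>j\<close> bound
            the distance by \<delta>.\<close>
          case True
          have "(\<lambda>i\<in>far b y. \<lambda>j\<in>{..<m}. c ((T ^^ j) ((T ^^ (b * m)) (y i)))) i j
             = (\<lambda>i\<in>far b z. \<lambda>j\<in>{..<m}. c ((T ^^ j) ((T ^^ (b * m)) (z i)))) i j"
            using arg_cong[OF *, of "\<lambda>p. snd (fst p) i j"] by (simp only: fst_conv snd_conv)
          then have "c ((T ^^ j) u) = c ((T ^^ j) v)"
            using True far j by (simp add: u_def v_def)
          then show ?thesis using uv by (intro c(4) funpow_in[OF T(2)])
        next
          \<comment> \<open>Both points start the block within \<open>r\<close> of the same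
            \<open>w\<close>. Distances grow by a factor of at most \<open>L ^ m\<close> within the
            block, so both orbits stay within \<delta>/2 of that of \<open>w\<close>.\<close>
          case False
          define w where "w = (T ^^ (b * m)) (x (near b y i))"
          have "near b y i = near b z i"
            using arg_cong[OF *, of "\<lambda>p. snd p i"] i
            by (simp only: snd_conv restrict_apply' lessThan_iff)
          then have w: "dist w u < r" "dist w v < r"
            using near[of i b y] near[of i b z] False far i by (simp_all add: w_def u_def v_def)
          have wX: "w \<in> X"
            unfolding w_def using x near_less[OF i] by (auto intro!: funpow_in[OF T(2)])
          have half: "dist ((T ^^ j) w) ((T ^^ j) p) \<le> \<delta> / 2" if "p \<in> X" "dist w p < r" for p
          proof -
            have "dist ((T ^^ j) w) ((T ^^ j) p) \<le> L ^ j * dist w p"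
              by (rule dist_funpow_le[OF T(1,2) wX that(1)])
            also have "\<dots> \<le> L ^ m * r"
              using that(2) j T(3) by (intro mult_mono power_increasing) auto
            finally show ?thesis using r by simp
          qed
          show ?thesis
            using half[OF uv(1) w(1)] half[OF uv(2) w(2)]
              dist_triangle3[of "(T ^^ j) u" "(T ^^ j) v" "(T ^^ j) w"] by simp
        qed
        then show ?thesis by (simp add: l funpow_add u_def v_def)
      qed
      then have "dyn_dist dist T n (y i) (z i) \<le> \<delta>"
        by (simp add: dyn_dist_le_iff[OF n(1)])
      then show ?thesis using E(3) yE[OF i] by (force simp: separated_def)
    qed
    then show "y = z" using yz by (intro PiE_ext[of y "{..<s}" "\<lambda>_. E"]) auto
  qed
  ultimately have "card ?B \<le> card ({..<k} \<rightarrow>\<^sub>E G)"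
    using finG by (intro card_inj_on_le[of \<Phi>]) (auto intro!: finite_PiE)
  also have "\<dots> = card G ^ k" by (simp add: card_funcsetE)
  also have "\<dots> \<le> (2 ^ s * card Q ^ (m * t) * s ^ s) ^ k"
    using cardG by (rule power_mono) simp
  finally show ?thesis .
qed

section \<open>Separated families of empirical measures\<close>

text \<open>Take \<open>F\<close> maximal among separated sets of empirical measures. Then every
  tuple is \<epsilon>-close along the orbit to a representative of some element of \<open>F\<close>,
  hence lies in its set of shadowed tuples, whose size is bounded. The condition on
  \<open>s\<close>, \<epsilon> and \<open>t\<close> caps the exceptional indices at
  \<open>t\<close>; \<open>b * m < n\<close> puts each block start among the controlled
  times.\<close>

lemma exists_separated_empirical:
  fixes X :: "'a::metric_space set" and Q :: "'q set"
  assumes X: "compact X" and T: "L-lipschitz_on X T" "T \<in> X \<rightarrow> X" "1 \<le> L"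
    and E: "finite E" "E \<subseteq> X" "separated dist T n \<delta> E"
    and c: "finite Q" "Q \<noteq> {}" "c \<in> X \<rightarrow> Q" "\<And>u v. u \<in> X \<Longrightarrow> v \<in> X \<Longrightarrow> c u = c v \<Longrightarrow> dist u v \<le> \<delta>"
    and n: "0 < n" "n \<le> k * m" "0 < m" "\<And>b. b < k \<Longrightarrow> b * m < n"
    and r: "L ^ m * r \<le> \<delta> / 2" "0 < r"
    and s: "0 < s" "real s * (2 * \<epsilon>) < real (Suc t) * r" "0 < \<epsilon>"
  obtains F where "finite F" "F \<subseteq> borel_probs X"
    "separated (wasserstein1 X) (pushforward X T) n \<epsilon> F"
    "card E ^ s \<le> card F * (2 ^ s * card Q ^ (m * t) * s ^ s) ^ k"
proof -
  let ?W = "wasserstein1 X" and ?P = "pushforward X T" and ?\<mu> = "empirical X s"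
  define Tup where "Tup = {..<s} \<rightarrow>\<^sub>E E"
  have finTup: "finite Tup" unfolding Tup_def using E(1) by (intro finite_PiE) auto
  have TupX: "x \<in> {..<s} \<rightarrow> X" if "x \<in> Tup" for x using that E(2) by (auto simp: Tup_def)
  have iterX: "(\<lambda>j. (T ^^ i) (x j)) \<in> {..<s} \<rightarrow> X" if "x \<in> Tup" for x i
    using TupX[OF that] by (auto intro: funpow_in[OF T(2)])
  have iter: "(?P ^^ i) (?\<mu> x) = ?\<mu> (\<lambda>j. (T ^^ i) (x j))" if "x \<in> Tup" for x i
    by (rule pushforward_funpow_empirical[OF lipschitz_on_continuous_on[OF T(1)] T(2) TupX[OF that]])
  have "\<exists>F\<in>{F. F \<subseteq> ?\<mu> ` Tup \<and> separated ?W ?P n \<epsilon> F}.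
      \<forall>F'\<in>{F. F \<subseteq> ?\<mu> ` Tup \<and> separated ?W ?P n \<epsilon> F}. F \<subseteq> F' \<longrightarrow> F = F'"
    (is "\<exists>F\<in>?M. _")
  proof (rule finite_has_maximal)
    show "finite ?M" using finTup by (intro finite_subset[of ?M "Pow (?\<mu> ` Tup)"]) auto
    have "{} \<in> ?M" by (simp add: separated_def)
    then show "?M \<noteq> {}" by blast
  qed
  then obtain F where F0: "F \<in> ?M" and max: "\<forall>F'\<in>?M. F \<subseteq> F' \<longrightarrow> F = F'"
    by (rule bexE)
  have F: "F \<subseteq> ?\<mu> ` Tup" "separated ?W ?P n \<epsilon> F" using F0 by simp_all
  \<comment> \<open>Permuted tuples have the same empirical measure, so one representative is chosen
    for each.\<close>
  have "\<forall>f\<in>F. \<exists>x. x \<in> Tup \<and> ?\<mu> x = f" using F(1) by blast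
  then obtain rep where rep: "\<And>f. f \<in> F \<Longrightarrow> rep f \<in> Tup \<and> ?\<mu> (rep f) = f"
    unfolding bchoice_iff by blast
  define B where "B x = {y \<in> Tup. \<forall>b<k.
    card {i\<in>{..<s}. \<forall>j<s. r \<le> dist ((T ^^ (b * m)) (x j)) ((T ^^ (b * m)) (y i))} \<le> t}" for x
  have "Tup \<subseteq> (\<Union>f\<in>F. B (rep f))"
  proof
    fix y assume y: "y \<in> Tup"
    \<comment> \<open>When enlarging \<open>F\<close> destroys separation, the failing pair may come
      in either order.\<close>
    have "\<exists>f\<in>F. dyn_dist ?W ?P n f (?\<mu> y) \<le> \<epsilon> \<or> dyn_dist ?W ?P n (?\<mu> y) f \<le> \<epsilon>"
    proof (cases "?\<mu> y \<in> F")
      case True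
      have "dyn_dist ?W ?P n (?\<mu> y) (?\<mu> y) \<le> \<epsilon>"
        using order_trans[OF wasserstein1_empirical_refl[OF s(1) iterX[OF y]] less_imp_le[OF s(3)]]
        by (simp add: dyn_dist_le_iff[OF n(1)] iter[OF y])
      then show ?thesis using True by blast
    next
      case False
      then have "\<not> separated ?W ?P n \<epsilon> (insert (?\<mu> y) F)"
        using bspec[OF max, of "insert (?\<mu> y) F"] F(1) y by auto
      then show ?thesis
        using F(2) by (simp only: separated_def not_less[symmetric]) blast
    qed
    then obtain f where f: "f \<in> F"
      and d: "dyn_dist ?W ?P n f (?\<mu> y) \<le> \<epsilon> \<or> dyn_dist ?W ?P n (?\<mu> y) f \<le> \<epsilon>" by blast
    define x where "x = rep f"
    have x: "x \<in> Tup" "f = ?\<mu> x" using rep[OF f] by (auto simp: x_def)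
    have "card {i\<in>{..<s}. \<forall>j<s. r \<le> dist ((T ^^ (b * m)) (x j)) ((T ^^ (b * m)) (y i))} \<le> t"
      (is "card ?S \<le> t") if b: "b < k" for b
    proof -
      have "?W (?\<mu> (\<lambda>j. (T ^^ (b * m)) (x j))) (?\<mu> (\<lambda>j. (T ^^ (b * m)) (y j))) \<le> \<epsilon> \<or>
            ?W (?\<mu> (\<lambda>j. (T ^^ (b * m)) (y j))) (?\<mu> (\<lambda>j. (T ^^ (b * m)) (x j))) \<le> \<epsilon>"
        using d n(4)[OF b] by (auto simp: x(2) dyn_dist_le_iff[OF n(1)] iter[OF y] iter[OF x(1)])
      \<comment> \<open>The bound on far points asks for a strict inequality, hence
        \<open>2 * \<epsilon>\<close> in place of \<epsilon>.\<close>
      then have "real (card ?S) * r \<le> real s * (2 * \<epsilon>)"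
      proof
        assume "?W (?\<mu> (\<lambda>j. (T ^^ (b * m)) (x j))) (?\<mu> (\<lambda>j. (T ^^ (b * m)) (y j))) \<le> \<epsilon>"
        then show ?thesis
          by (intro wasserstein1_card_far_points(1)[OF X s(1) iterX[OF x(1)] iterX[OF y] _ r(2)])
             (use s(3) in simp)
      next
        assume "?W (?\<mu> (\<lambda>j. (T ^^ (b * m)) (y j))) (?\<mu> (\<lambda>j. (T ^^ (b * m)) (x j))) \<le> \<epsilon>"
        then show ?thesis
          by (intro wasserstein1_card_far_points(2)[OF X s(1) iterX[OF y] iterX[OF x(1)] _ r(2)])
             (use s(3) in simp)
      qed
      also note s(2)
      finally show ?thesis using r(2) by simp
    qed
    then show "y \<in> (\<Union>f\<in>F. B (rep f))" using y f by (auto simp: B_def x_def)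
  qed
  then have "card Tup \<le> card (\<Union>f\<in>F. B (rep f))"
    using finTup finite_subset[OF F(1)] by (intro card_mono) (auto simp: B_def)
  also have "\<dots> \<le> (\<Sum>f\<in>F. card (B (rep f)))"
    using finTup finite_subset[OF F(1)] by (intro card_UN_le) auto
  also have "\<dots> \<le> (\<Sum>f\<in>F. (2 ^ s * card Q ^ (m * t) * s ^ s) ^ k)"
    unfolding B_def Tup_def
    using rep TupX by (intro sum_mono card_shadowed_tuples_le[OF T E c n(1-3) r(1)]) auto
  also have "\<dots> = card F * (2 ^ s * card Q ^ (m * t) * s ^ s) ^ k" by simp
  also have "card Tup = card E ^ s" by (simp add: Tup_def card_funcsetE)
  finally show thesis
    using that[of F] F finite_subset[OF F(1)] finTup
      empirical_in_borel_probs[OF s(1) TupX] by blast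
qed


section \<open>Growth along infinitely many times, and division into blocks\<close>

lemma le_limsup_if_frequently:
  fixes f :: "nat \<Rightarrow> ereal"
  assumes "\<exists>\<^sub>F n in sequentially. c \<le> f n"
  shows "c \<le> limsup f"
proof (rule ccontr)
  assume "\<not> c \<le> limsup f"
  then have "\<forall>\<^sub>F n in sequentially. f n < c" by (intro Limsup_lessD) simp
  then show False using assms by (auto simp: frequently_def not_le)
qed

text \<open>Otherwise all separated sets would eventually have at most \<open>exp (h * n)\<close>
  points, forcing the upper limit down to \<open>h\<close>.\<close>

lemma frequently_large_separated:
  fixes h :: real
  assumes "0 < h" "ereal h < scale_entropy \<rho> S Y \<delta>"
  shows "\<exists>\<^sub>F n in sequentially. \<exists>E. finite E \<and> E \<subseteq> Y \<and> separated \<rho> S n \<delta> E \<and> exp (h * n) < card E"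
proof (rule ccontr)
  assume "\<not> ?thesis"
  then have "\<forall>\<^sub>F n in sequentially. \<forall>E. finite E \<and> E \<subseteq> Y \<and> separated \<rho> S n \<delta> E \<longrightarrow> card E \<le> exp (h * n)"
    unfolding not_frequently by (rule eventually_mono) (auto simp: not_less)
  then have "\<forall>\<^sub>F n in sequentially. ereal (1 / real n) * ln_enat (sep_number \<rho> S Y \<delta> n) \<le> ereal h"
    using eventually_gt_at_top[of 0]
  proof eventually_elim
    case (elim n)
    \<comment> \<open>An integer bound passes to the supremum in \<open>enat\<close>;
      \<open>h > 0\<close> keeps it at least 1, away from the convention
      \<open>ln 0 = 0\<close>.\<close>
    define N where "N = nat \<lfloor>exp (h * n)\<rfloor>"
    have "1 \<le> exp (h * n)" using assms(1) by simp
    then have N: "1 \<le> N" "real N \<le> exp (h * n)" by (auto simp: N_def le_nat_iff le_floor_iff)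
    have "sep_number \<rho> S Y \<delta> n \<le> enat N"
      unfolding sep_number_def N_def using elim(1)
      by (intro SUP_least) (auto simp: le_nat_iff le_floor_iff)
    then have "ln_enat (sep_number \<rho> S Y \<delta> n) \<le> ln_enat (enat N)" by (rule ln_enat_mono)
    also have "\<dots> \<le> ereal (h * n)"
      using N ln_mono[of "real N" "exp (h * n)"] by (simp add: ln_enat_def)
    finally have "ereal (1 / real n) * ln_enat (sep_number \<rho> S Y \<delta> n) \<le> ereal (1 / real n) * ereal (h * n)"
      by (rule ereal_mult_left_mono) simp
    also have "\<dots> = ereal h" using elim(2) by simp
    finally show ?case .
  qed
  then have "scale_entropy \<rho> S Y \<delta> \<le> ereal h" unfolding scale_entropy_def by (rule Limsup_bounded)
  then show False using assms(2) by simp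
qed

lemma obtain_blocks:
  assumes "0 < (m::nat)" "m \<le> n"
  obtains k where "n \<le> k * m" "k * m \<le> 2 * n" "\<And>b. b < k \<Longrightarrow> b * m < n"
proof -
  \<comment> \<open>This is \<open>n / m\<close> rounded up: the last block may overrun
    \<open>n\<close> but still starts before it, and \<open>m \<le> n\<close> limits the total
    length to \<open>2 * n\<close>.\<close>
  define k where "k = Suc ((n - 1) div m)"
  have *: "(n - 1) div m * m \<le> n - 1" by simp
  have "n - 1 < (n - 1) div m * m + m"
    using assms(1) mod_less_divisor[of m "n - 1"] div_mult_mod_eq[of "n - 1" m] by linarith
  moreover have "k * m = (n - 1) div m * m + m" by (simp add: k_def)
  ultimately have "n \<le> k * m" "k * m \<le> 2 * n" using assms * by linarith+
  moreover have "b * m < n" if "b < k" for b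
  proof -
    have "b * m \<le> (n - 1) div m * m" using that by (simp add: k_def)
    then show ?thesis using * assms by linarith
  qed
  ultimately show thesis by (rule that)
qed

section \<open>Lower bound at the scales \<open>c / L ^ m\<close>\<close>

lemma scale_entropy_empirical_ge:
  fixes X :: "'a::metric_space set" and h :: real
  assumes X: "compact X" and T: "L-lipschitz_on X T" "T \<in> X \<rightarrow> X" "1 \<le> L"
    and h: "0 < h" "ereal h < scale_entropy dist T X \<delta>" and \<delta>: "0 < \<delta>"
  shows "\<exists>c>0. \<forall>m::nat. 8 / h \<le> m \<longrightarrow>
    ereal (h / 8 * exp (h * m / 8)) \<le>
      scale_entropy (wasserstein1 X) (pushforward X T) (borel_probs X) (c / L ^ m)"
proof -
  obtain Q :: "'a set" and c where c: "finite Q" "c \<in> X \<rightarrow> Q"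
    "\<And>x y. x \<in> X \<Longrightarrow> y \<in> X \<Longrightarrow> c x = c y \<Longrightarrow> dist x y \<le> \<delta>"
    using compact_finite_code[OF X \<delta>] by blast
  obtain n E where nE: "E \<subseteq> X" "exp (h * real n) < card E"
    using frequently_ex[OF frequently_large_separated[OF h]] by blast
  then have "E \<noteq> {}" using less_trans[OF exp_gt_zero] by fastforce
  then have Q: "Q \<noteq> {}" using nE(1) c(2) by auto
  \<comment> \<open>The added 1 keeps \<open>D\<close> positive, so that it can be divided by, even
    when \<open>Q\<close> is a singleton.\<close>
  define D where "D = ln (card Q) + 1"
  have "1 \<le> card Q" using Q c(1) by (simp add: Suc_le_eq card_gt_0_iff)
  then have D: "0 \<le> ln (card Q)" "ln (card Q) \<le> D" "0 < D" by (auto simp: D_def add_nonneg_pos)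
  \<comment> \<open>The tolerated proportion of exceptional points, chosen so that their itineraries
    cost at most \<open>s * h * m / 8\<close> per block.\<close>
  define \<eta> where "\<eta> = h / (8 * D)"
  have \<eta>: "0 < \<eta>" "\<eta> * D = h / 8" using h(1) D(3) by (auto simp: \<eta>_def)
  \<comment> \<open>Solves \<open>2 * K / L ^ m = \<eta> * r\<close> for the radius \<open>r\<close>
    below.\<close>
  define K where "K = \<eta> * \<delta> / 4"
  have K: "0 < K" using \<eta> \<delta> by (simp add: K_def)
  have "ereal (h / 8 * exp (h * m / 8)) \<le>
      scale_entropy (wasserstein1 X) (pushforward X T) (borel_probs X) (K / L ^ m)"
    if m: "8 / h \<le> real m" for m :: nat
  proof -
    \<comment> \<open>This lets the \<open>2 ^ s\<close> choices of exceptional sets be absorbed, as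
      \<open>ln 2 < 1\<close>.\<close>
    have hm: "1 \<le> h * m / 8" using m h(1) by (simp add: field_simps)
    have m0: "0 < m" using hm by (cases m) auto
    have Lm: "0 < L ^ m" using T(3) by simp
    define s where "s = nat \<lfloor>exp (h * m / 8)\<rfloor>"
    define t where "t = nat \<lfloor>\<eta> * s\<rfloor>"
    define r where "r = \<delta> / (2 * L ^ m)"
    have e1: "1 \<le> exp (h * m / 8)" using hm by simp
    have s: "real s \<le> exp (h * m / 8)" "exp (h * m / 8) / 2 \<le> real s" "0 < s"
    proof -
      have s_eq: "real s = real_of_int \<lfloor>exp (h * m / 8)\<rfloor>" and "1 \<le> real s"
        using e1 by (simp_all add: s_def le_nat_iff le_floor_iff)
      then show "0 < s" "exp (h * m / 8) / 2 \<le> real s" "real s \<le> exp (h * m / 8)"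
        using real_of_int_floor_add_one_gt[of "exp (h * m / 8)"] by linarith+
    qed
    have lns: "ln s \<le> h * m / 8" using ln_mono[OF s(1)] s(3) by simp
    have t: "real t \<le> \<eta> * s" "\<eta> * s < real (Suc t)"
      using \<eta>(1) unfolding t_def by (simp_all add: of_nat_floor) linarith
    have r: "L ^ m * r \<le> \<delta> / 2" "0 < r" using Lm \<delta> by (auto simp: r_def)
    have "real s * (2 * (K / L ^ m)) = \<eta> * s * r" using Lm by (simp add: K_def r_def field_simps)
    also have "\<dots> < real (Suc t) * r" using t(2) r(2) by (rule mult_strict_right_mono)
    finally have st: "real s * (2 * (K / L ^ m)) < real (Suc t) * r" .
    \<comment> \<open>Each of the three factors of the block count contributes at most
      \<open>s * h * m / 8\<close>.\<close>
    have lnsum: "s * ln 2 + m * t * ln (card Q) + s * ln s \<le> 3 / 8 * h * s * m"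
    proof -
      have "s * ln 2 \<le> s * (h * m / 8)" using hm ln_2_less_1 by (intro mult_left_mono) auto
      moreover have "s * ln s \<le> s * (h * m / 8)" using lns by (intro mult_left_mono) auto
      moreover have "m * (t * ln (card Q)) \<le> m * (\<eta> * s * D)"
        using t(1) D \<eta>(1) by (intro mult_left_mono mult_mono) auto
      moreover have "m * (\<eta> * s * D) = s * (\<eta> * D * m)" by simp
      then have "m * (\<eta> * s * D) = s * (h * m / 8)" by (simp add: \<eta>(2))
      ultimately have "s * ln 2 + m * (t * ln (card Q)) + s * ln s \<le> 3 * (s * (h * m / 8))" by linarith
      then show ?thesis by (simp add: mult_ac)
    qed
    have "\<exists>\<^sub>F n in sequentially. (\<exists>E. finite E \<and> E \<subseteq> X \<and> separated dist T n \<delta> E \<and> exp (h * n) < card E) \<and> m \<le> n"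
      using frequently_large_separated[OF h] eventually_ge_at_top by (rule frequently_eventually_frequently)
    then have "\<exists>\<^sub>F n in sequentially. ereal (h * s / 4) \<le>
      ereal (1 / real n) * ln_enat (sep_number (wasserstein1 X) (pushforward X T) (borel_probs X) (K / L ^ m) n)"
    proof (rule frequently_elim1)
      fix n assume "(\<exists>E. finite E \<and> E \<subseteq> X \<and> separated dist T n \<delta> E \<and> exp (h * n) < card E) \<and> m \<le> n"
      then obtain E where E: "finite E" "E \<subseteq> X" "separated dist T n \<delta> E" and cE: "exp (h * n) < card E"
        and mn: "m \<le> n" by blast
      have n0: "0 < n" using m0 mn by simp
      obtain k where k: "n \<le> k * m" "k * m \<le> 2 * n" "\<And>b. b < k \<Longrightarrow> b * m < n"
        using obtain_blocks[OF m0 mn] by blast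
      have "0 < K / L ^ m" using K Lm by simp
      from exists_separated_empirical[OF X T E c(1) Q c(2,3) n0 k(1) m0 k(3) r s(3) st this]
      obtain F where F: "finite F" "F \<subseteq> borel_probs X"
        "separated (wasserstein1 X) (pushforward X T) n (K / L ^ m) F"
        and cF: "card E ^ s \<le> card F * (2 ^ s * card Q ^ (m * t) * s ^ s) ^ k" by blast
      have E0: "0 < card E" using less_trans[OF exp_gt_zero cE] by simp
      then have F0: "0 < card F" using cF by (cases "card F") auto
      have q0: "0 < card Q" using Q c(1) by (simp add: card_gt_0_iff)
      \<comment> \<open>Compare logarithms: tuples contribute \<open>h * s * n\<close>, while the
        blocks, of total length at most \<open>2 * n\<close>, use at most
        \<open>3/4 * h * s * n\<close>. A quarter remains for \<open>F\<close>.\<close>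
      have "s * (h * n) \<le> s * ln (card E)"
        using cE E0 by (intro mult_left_mono) (auto simp: ln_ge_iff)
      also have "\<dots> = ln (real (card E ^ s))" using E0 by (simp add: ln_realpow)
      also have "\<dots> \<le> ln (real (card F * (2 ^ s * card Q ^ (m * t) * s ^ s) ^ k))"
        using cF E0 F0 q0 s(3) by (subst ln_le_cancel_iff) (auto simp only: of_nat_le_iff of_nat_0_less_iff zero_less_power mult_pos_pos zero_less_numeral)
      also have "\<dots> = ln (card F) + k * (s * ln 2 + m * t * ln (card Q) + s * ln s)"
        using F0 q0 s(3) by (simp add: ln_mult ln_realpow)
      also have "k * (s * ln 2 + m * t * ln (card Q) + s * ln s) \<le> k * (3 / 8 * h * s * m)"
        using lnsum by (intro mult_left_mono) auto
      also have "\<dots> = 3 / 8 * h * s * (k * m)" by simp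
      also have "\<dots> \<le> 3 / 8 * h * s * (2 * n)"
        using k(2) h(1) by (intro mult_left_mono) (auto simp flip: of_nat_mult)
      finally have "h * s / 4 * n \<le> ln (card F)" by (simp add: algebra_simps)
      then have "ereal (h * s / 4) \<le> ereal (1 / real n) * ln_enat (enat (card F))"
        using n0 by (simp add: ln_enat_def field_simps)
      also have "\<dots> \<le> ereal (1 / real n) * ln_enat (sep_number (wasserstein1 X) (pushforward X T) (borel_probs X) (K / L ^ m) n)"
        unfolding sep_number_def using F
        by (intro ereal_mult_left_mono ln_enat_mono SUP_upper) auto
      finally show "ereal (h * s / 4) \<le> ereal (1 / real n) *
        ln_enat (sep_number (wasserstein1 X) (pushforward X T) (borel_probs X) (K / L ^ m) n)" .
    qed
    then have "ereal (h * s / 4) \<le> scale_entropy (wasserstein1 X) (pushforward X T) (borel_probs X) (K / L ^ m)"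
      unfolding scale_entropy_def by (rule le_limsup_if_frequently)
    moreover have "h / 8 * exp (h * m / 8) \<le> h * s / 4"
      using mult_left_mono[OF s(2), of "h / 4"] h(1) by simp
    ultimately show ?thesis by (meson ereal_less_eq(3) order_trans)
  qed
  then show ?thesis using K by blast
qed

section \<open>From geometric scales to all small scales\<close>

text \<open>Entropy is antitone in the scale, so each small \<epsilon> is compared with a nearby
  geometric scale above it. Some cutoff for \<epsilon> is unavoidable: at scales beyond the diameter
  of \<open>X\<close> the entropy is 0.\<close>

theorem theorem2:
  fixes X :: "'a::metric_space set" and T :: "'a \<Rightarrow> 'a" and L :: real
  assumes "compact X"
    and "T \<in> X \<rightarrow> X"
    and "L-lipschitz_on X T"
    and "topological_entropy dist T X > 0"
  shows "\<exists>C>0. \<exists>\<alpha>>0. \<exists>\<epsilon>\<^sub>0>0. \<forall>\<epsilon>. 0 < \<epsilon> \<and> \<epsilon> < \<epsilon>\<^sub>0 \<longrightarrow>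
    scale_entropy (wasserstein1 X) (pushforward X T) (borel_probs X) \<epsilon>
      \<ge> ereal (C * \<epsilon> powr (- \<alpha>))"
proof -
  obtain \<delta> where \<delta>: "0 < \<delta>" "0 < scale_entropy dist T X \<delta>"
    using assms(4) unfolding topological_entropy_eq_SUP less_SUP_iff by auto
  obtain h where h: "0 < h" "ereal h < scale_entropy dist T X \<delta>"
    using ereal_dense2[OF \<delta>(2)] by (auto simp: zero_ereal_def)
  \<comment> \<open>Enlarging the Lipschitz constant makes \<open>ln M\<close> positive, as the
    exponent \<alpha> requires.\<close>
  define M where "M = max L 2"
  have M: "1 \<le> M" "0 < ln M" "0 < M" by (auto simp: M_def)
  have TM: "M-lipschitz_on X T"
    using assms(3) by (rule lipschitz_on_le) (simp add: M_def)
  obtain c where c: "0 < c" and ge: "\<And>m::nat. 8 / h \<le> m \<Longrightarrow> ereal (h / 8 * exp (h * m / 8)) \<le>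
      scale_entropy (wasserstein1 X) (pushforward X T) (borel_probs X) (c / M ^ m)"
    using scale_entropy_empirical_ge[OF assms(1) TM assms(2) M(1) h \<delta>(1)] by blast
  \<comment> \<open>Chosen so that \<open>exp (h * m / 8)\<close> equals
    \<open>(M ^ m) powr \<alpha>\<close>; in \<open>C\<close> below, \<open>exp (- (h / 8))\<close>
    pays for rounding \<open>z\<close> down to \<open>m\<close>.\<close>
  define \<alpha> where "\<alpha> = h / (8 * ln M)"
  define C where "C = h / 8 * exp (- (h / 8)) * c powr \<alpha>"
  \<comment> \<open>Below this cutoff \<open>z\<close> exceeds \<open>8 / h + 1\<close>, so its
    integer part is still at least \<open>8 / h\<close>.\<close>
  define \<epsilon>\<^sub>0 where "\<epsilon>\<^sub>0 = c / exp ((8 / h + 1) * ln M)"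
  have "ereal (C * \<epsilon> powr (- \<alpha>)) \<le> scale_entropy (wasserstein1 X) (pushforward X T) (borel_probs X) \<epsilon>"
    if \<epsilon>: "0 < \<epsilon>" "\<epsilon> < \<epsilon>\<^sub>0" for \<epsilon>
  proof -
    \<comment> \<open>The real exponent at which the geometric scale is exactly \<epsilon>.\<close>
    define z where "z = ln (c / \<epsilon>) / ln M"
    have z: "c / \<epsilon> = exp (z * ln M)" using M c \<epsilon>(1) by (simp add: z_def)
    have "exp ((8 / h + 1) * ln M) < c / \<epsilon>"
      using \<epsilon> by (simp only: \<epsilon>\<^sub>0_def pos_less_divide_eq exp_gt_zero mult.commute)
    then have z_ge: "8 / h + 1 < z" using M(2) by (simp add: z)
    define m where "m = nat \<lfloor>z\<rfloor>"
    have "0 < z" using z_ge h(1) by (smt (verit) divide_pos_pos)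
    then have m: "real m \<le> z" "z \<le> m + 1" unfolding m_def by linarith+
    have "8 / h \<le> m" using m z_ge by linarith
    have "M ^ m = exp (m * ln M)" using M(3) by (simp add: exp_of_nat_mult)
    also have "\<dots> \<le> c / \<epsilon>" using m(1) M(2) by (simp add: z)
    finally have "\<epsilon> \<le> c / M ^ m"
      using \<epsilon>(1) M(3) by (simp only: pos_le_divide_eq zero_less_power mult.commute)
    have "(c / \<epsilon>) powr \<alpha> = c powr \<alpha> * \<epsilon> powr (- \<alpha>)"
      using c \<epsilon>(1) by (simp add: powr_divide powr_minus_divide)
    then have "C * \<epsilon> powr (- \<alpha>) = h / 8 * (exp (- (h / 8)) * (c / \<epsilon>) powr \<alpha>)"
      by (simp add: C_def)
    also have "(c / \<epsilon>) powr \<alpha> = exp (h * z / 8)"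
      using M(2) by (simp add: z powr_def \<alpha>_def)
    also have "exp (- (h / 8)) * exp (h * z / 8) \<le> exp (h * m / 8)"
      using m(2) h(1) mult_left_mono[OF m(2), of h] by (simp add: mult_exp_exp algebra_simps)
    finally have "ereal (C * \<epsilon> powr (- \<alpha>)) \<le> ereal (h / 8 * exp (h * m / 8))"
      using h(1) by simp
    also note ge[OF \<open>8 / h \<le> m\<close>]
    also note scale_entropy_antimono[OF \<open>\<epsilon> \<le> c / M ^ m\<close>]
    finally show ?thesis .
  qed
  moreover have "0 < C" "0 < \<alpha>" "0 < \<epsilon>\<^sub>0" using h(1) c M(2) by (auto simp: C_def \<alpha>_def \<epsilon>\<^sub>0_def)
  ultimately show ?thesis by blast
qed

end
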